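(* Consider the followers' Fokker-Planck equation described in the context, with all compromise functions identically $1$ and all local diffusion functions equal to $D(w)=1-w^2$. As $t\to\infty$ the mean opinions $m_F$ and $m_L$ of followers and leaders relax to the desired opinion $w_d$, and the steady state $f_{F,\infty}$ of the followers' equation is then a solution of $$\left(\frac1{c_F}+\frac{\rho}{c_{FL}}\right)(w_d-w)\,f_{F,\infty}=\frac12\left(\frac{\varsigma^2}{c_F}+\frac{\hat\varsigma^2\rho}{c_{FL}}\right)\frac{\partial}{\partial w}\Big(D^2(w)f_{F,\infty}\Big).$$ Writing $g_{F,\infty}=D^2(w)f_{F,\infty}$, one has $$g_{F,\infty}=a_F\exp\left\{-\frac{2}{b_F}\int_0^w\frac{z-w_d}{(1-z^2)^2}\,dz\right\},\qquad b_F=\frac{\varsigma^2c_{FL}+\hat\varsigma^2c_F\rho}{c_{FL}+c_F\rho},$$ where $a_F$ is a normalization constant such that $\int_I g_{F,\infty}\,dw=1$, and therefore $$f_{F,\infty}=\frac{a_F}{(1-w^2)^2}\exp\left\{-\frac{2}{b_F}\int_0^w\frac{z-w_d}{(1-z^2)^2}\,dz\right\}.$$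
   Context: Let $I=[-1,1]$. The followers' opinion density is $f_F(w,t)$, $w\in I$, and the leaders' opinion density $f_L(\tilde w,t)$, $\tilde w\in I$, has total mass $\rho\le 1$. The mean opinions are $m_F(t)=\int_I wf_F(w,t)\,dw$ and $m_L(t)=\frac1\rho\int_I\tilde wf_L(\tilde w,t)\,d\tilde w$. The constants $c_F,c_{FL},c_L$ come from the scaling of the follower-follower, leader-follower and leader-leader interaction frequencies, $\varsigma^2$ and $\hat\varsigma^2$ are the scaled variances of the noise in follower-follower and leader-follower interactions, $\kappa$ is the scaled penalization of the leaders' control, $w_d$ is the leaders' desired opinion, and $\psi,\mu$ are nonnegative weights with $\psi+\mu=1$. With unit compromise functions and all local diffusion functions equal to $D(w)=1-w^2$, the followers' density evolves by the Fokker-Planck equation $$\partial_t f_F+\partial_w\Big[\Big(\tfrac1{c_F}(m_F-w)+\tfrac{\rho}{c_{FL}}(m_L-w)\Big)f_F\Big]=\tfrac12\Big(\tfrac{\varsigma^2}{c_F}+\tfrac{\hat\varsigma^2\rho}{c_{FL}}\Big)\partial_w^2\big(D^2(w)f_F\big),$$ and the mean opinions evolve by $$\frac{d}{dt}m_F=\frac{\rho}{c_{FL}}(m_L-m_F),\qquad \frac{d}{dt}m_L=\frac{4\rho}{c_L\kappa}\big[\psi(w_d-m_L)+\mu(m_F-m_L)\big].$$ The steady state is understood as the zero-flux stationary state, that is, the solution of $$\Big(\tfrac1{c_F}(m_F-w)+\tfrac{\rho}{c_{FL}}(m_L-w)\Big)f_{F,\infty}=\tfrac12\Big(\tfrac{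\varsigma^2}{c_F}+\tfrac{\hat\varsigma^2\rho}{c_{FL}}\Big)\partial_w\big(D^2(w)f_{F,\infty}\big).$$
   Formalization: Assumes ψ>0 (for ψ=0 the means need not tend to w_d) and noise variances not both zero (else b_F=0); existence of a_F is claimed only if |w_d|<1 or b_F>1/2, since for |w_d|=1, b_F≤1/2 the profile is not integrable. *)

theory Defs
  imports "HOL-Analysis.Analysis"
begin

definition opinion_space :: "real set" where
  "opinion_space = {-1..1}"

definition local_diffusion :: "real \<Rightarrow> real" where
  "local_diffusion w = 1 - w\<^sup>2"

text \<open>Densities are written \<open>f w t\<close>, with the opinion first and the time second, and are
  understood for \<open>t > 0\<close>.\<close>

definition opinion_density :: "(real \<Rightarrow> real \<Rightarrow> real) \<Rightarrow> bool" where
  "opinion_density f \<longleftrightarrow>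
     (\<forall>t>0. (\<forall>w\<in>opinion_space. 0 \<le> f w t) \<and>
            set_integrable lborel opinion_space (\<lambda>w. f w t))"

definition follower_mean :: "(real \<Rightarrow> real \<Rightarrow> real) \<Rightarrow> real \<Rightarrow> real" where
  "follower_mean fF t = (LBINT w:opinion_space. w * fF w t)"

definition leader_mean :: "real \<Rightarrow> (real \<Rightarrow> real \<Rightarrow> real) \<Rightarrow> real \<Rightarrow> real" where
  "leader_mean \<rho> fL t = 1 / \<rho> * (LBINT w:opinion_space. w * fL w t)"

definition follower_drift :: "real \<Rightarrow> real \<Rightarrow> real \<Rightarrow> real \<Rightarrow> real \<Rightarrow> real \<Rightarrow> real" where
  "follower_drift cF cFL \<rho> mF mL w = 1 / cF * (mF - w) + \<rho> / cFL * (mL - w)"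

text \<open>\<open>\<sigma>\<close> and \<open>\<sigma>'\<close> are the standard deviations of the follower-follower and of the
  leader-follower noise, so that \<open>\<sigma>\<^sup>2\<close> and \<open>\<sigma>'\<^sup>2\<close> are the variances.\<close>

definition diffusion_coeff :: "real \<Rightarrow> real \<Rightarrow> real \<Rightarrow> real \<Rightarrow> real \<Rightarrow> real" where
  "diffusion_coeff cF cFL \<rho> \<sigma> \<sigma>' = 1 / 2 * (\<sigma>\<^sup>2 / cF + \<sigma>'\<^sup>2 * \<rho> / cFL)"

text \<open>Classical solutions. The equation is imposed in the open interval: the diffusion
  degenerates at the two endpoints, where the steady profile divides by zero.\<close>

definition follower_fokker_planck ::
  "real \<Rightarrow> real \<Rightarrow> real \<Rightarrow> real \<Rightarrow> real \<Rightarrow> (real \<Rightarrow> real) \<Rightarrow> (real \<Rightarrow> real)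
     \<Rightarrow> (real \<Rightarrow> real \<Rightarrow> real) \<Rightarrow> bool" where
  "follower_fokker_planck cF cFL \<rho> \<sigma> \<sigma>' mF mL fF \<longleftrightarrow>
     (\<forall>t>0. \<forall>w\<in>{-1<..<1}.
        (\<lambda>s. fF w s) field_differentiable at t \<and>
        (\<lambda>x. follower_drift cF cFL \<rho> (mF t) (mL t) x * fF x t) field_differentiable at w \<and>
        (\<lambda>x. (local_diffusion x)\<^sup>2 * fF x t) field_differentiable at w \<and>
        deriv (\<lambda>x. (local_diffusion x)\<^sup>2 * fF x t) field_differentiable at w \<and>
        deriv (\<lambda>s. fF w s) t
          + deriv (\<lambda>x. follower_drift cF cFL \<rho> (mF t) (mL t) x * fF x t) w
        = diffusion_coeff cF cFL \<rho> \<sigma> \<sigma>'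
          * deriv (deriv (\<lambda>x. (local_diffusion x)\<^sup>2 * fF x t)) w)"

definition mean_opinion_dynamics ::
  "real \<Rightarrow> real \<Rightarrow> real \<Rightarrow> real \<Rightarrow> real \<Rightarrow> real \<Rightarrow> real \<Rightarrow> (real \<Rightarrow> real) \<Rightarrow> (real \<Rightarrow> real) \<Rightarrow> bool" where
  "mean_opinion_dynamics cFL cL \<rho> \<kappa> \<psi> \<mu> wd mF mL \<longleftrightarrow>
     (\<forall>t>0. (mF has_real_derivative \<rho> / cFL * (mL t - mF t)) (at t) \<and>
            (mL has_real_derivative
               4 * \<rho> / (cL * \<kappa>) * (\<psi> * (wd - mL t) + \<mu> * (mF t - mL t))) (at t))"

definition zero_flux_state ::
  "real \<Rightarrow> real \<Rightarrow> real \<Rightarrow> real \<Rightarrow> real \<Rightarrow> real \<Rightarrow> real \<Rightarrow> (real \<Rightarrow> real) \<Rightarrow> bool" where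
  "zero_flux_state cF cFL \<rho> \<sigma> \<sigma>' mF mL f \<longleftrightarrow>
     (\<forall>w\<in>{-1<..<1}.
        (\<lambda>x. (local_diffusion x)\<^sup>2 * f x) field_differentiable at w \<and>
        follower_drift cF cFL \<rho> mF mL w * f w
        = diffusion_coeff cF cFL \<rho> \<sigma> \<sigma>' * deriv (\<lambda>x. (local_diffusion x)\<^sup>2 * f x) w)"

text \<open>The coefficients of the Fokker-Planck equation depend on time through the mean opinions;
  a steady state is a zero-flux state for their limits as \<open>t \<rightarrow> \<infinity>\<close>. Its mass is not fixed.\<close>

definition follower_steady_state ::
  "real \<Rightarrow> real \<Rightarrow> real \<Rightarrow> real \<Rightarrow> real \<Rightarrow> (real \<Rightarrow> real) \<Rightarrow> (real \<Rightarrow> real) \<Rightarrow> (real \<Rightarrow> real) \<Rightarrow> bool" where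
  "follower_steady_state cF cFL \<rho> \<sigma> \<sigma>' mF mL f \<longleftrightarrow>
     (\<exists>mF_inf mL_inf. (mF \<longlongrightarrow> mF_inf) at_top \<and> (mL \<longlongrightarrow> mL_inf) at_top \<and>
        zero_flux_state cF cFL \<rho> \<sigma> \<sigma>' mF_inf mL_inf f)"

definition b_F :: "real \<Rightarrow> real \<Rightarrow> real \<Rightarrow> real \<Rightarrow> real \<Rightarrow> real" where
  "b_F cF cFL \<rho> \<sigma> \<sigma>' = (\<sigma>\<^sup>2 * cFL + \<sigma>'\<^sup>2 * cF * \<rho>) / (cFL + cF * \<rho>)"

text \<open>The interval integral is oriented, as required for \<open>w < 0\<close>.\<close>

definition steady_profile :: "real \<Rightarrow> real \<Rightarrow> real \<Rightarrow> real" where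
  "steady_profile b wd w =
     exp (- (2 / b) * (LBINT z=0..ereal w. (z - wd) / (1 - z\<^sup>2)\<^sup>2))"

end

theory Submission
  imports Defs
begin

text \<open>
  The deviations of the two means from \<open>wd\<close> satisfy a linear system in which the followers are
  pulled towards the leaders and the leaders towards the average of the followers and \<open>wd\<close> with
  weights \<open>\<mu>\<close> and \<open>\<psi>\<close>; because \<open>\<psi> > 0\<close> gives \<open>\<mu> < 1\<close>, a weighted sum of their squares decays exponentially
  (\<open>linear_relaxation\<close>). A steady state is therefore a zero-flux state with both means equal to
  \<open>wd\<close>, and the two drift terms merge into one.

  In terms of \<open>g = D\<^sup>2 f\<close> the zero-flux condition is the linear equation
  \<open>g' = (2 / b) (wd - w) / (1 - w\<^sup>2)\<^sup>2 g\<close> on the open interval. The exponential profile is a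
  positive solution, so the quotient of any solution by it has derivative zero and is a constant
  \<open>a\<close> (\<open>zero_flux_state_iff_profile\<close>). Requiring unit mass of \<open>g\<close> is then the same as requiring it of
  \<open>a\<close> times the profile.

  Such an \<open>a\<close> exists, and only once, as soon as the profile is integrable
  (\<open>set_integrable_steady_profile\<close>). The exponent is known in closed form. For \<open>\<bar>wd\<bar> < 1\<close> its
  potential has its minimum at \<open>wd\<close> and the profile is bounded. For \<open>wd = \<plusminus>1\<close> the numerator
  \<open>z - wd\<close> cancels one of the two zeros of the denominator there, so the singularity of the potential
  at \<open>wd\<close> is only logarithmic and the profile grows like
  \<open>(1 - wd w)\<close> to the power \<open>- 1 / (2 b)\<close>, which is integrable exactly when \<open>b > 1 / 2\<close>.
\<close>

section \<open>Relaxation of the mean opinions\<close>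

text \<open>The Lyapunov function is \<open>x\<^sup>2 / \<alpha> + y\<^sup>2 / \<beta>\<close>: with these weights the rates cancel in its
  derivative, which becomes \<open>2 ((1 + \<mu>) x y - x\<^sup>2 - y\<^sup>2)\<close>, a negative definite form since
  \<open>1 + \<mu> < 2\<close>.\<close>
lemma linear_relaxation:
  fixes x y :: "real \<Rightarrow> real" and \<alpha> \<beta> \<mu> :: real
  assumes pos: "0 < \<alpha>" "0 < \<beta>" "0 \<le> \<mu>" "\<mu> < 1"
    and x: "\<And>t. 0 < t \<Longrightarrow> (x has_real_derivative \<alpha> * (y t - x t)) (at t)"
    and y: "\<And>t. 0 < t \<Longrightarrow> (y has_real_derivative \<beta> * (\<mu> * x t - y t)) (at t)"
  shows "(x \<longlongrightarrow> 0) at_top" and "(y \<longlongrightarrow> 0) at_top"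
proof -
  define V where "V t = (x t)\<^sup>2 / \<alpha> + (y t)\<^sup>2 / \<beta>" for t
  define c where "c = (1 - \<mu>) * min \<alpha> \<beta>"
  have c: "0 < c" using pos by (simp add: c_def)
  have V': "(V has_real_derivative 2 * ((1 + \<mu>) * (x t * y t) - (x t)\<^sup>2 - (y t)\<^sup>2)) (at t)"
    if "0 < t" for t
    unfolding V_def using pos
    by (auto intro!: derivative_eq_intros x[OF that] y[OF that]
        simp: field_simps power2_eq_square)
  \<comment> \<open>From \<open>2 x y \<le> x\<^sup>2 + y\<^sup>2\<close>; the factor \<open>min \<alpha> \<beta>\<close> in \<open>c\<close> compares \<open>x\<^sup>2 + y\<^sup>2\<close> with \<open>V\<close>.\<close>
  have decay: "2 * ((1 + \<mu>) * (x t * y t) - (x t)\<^sup>2 - (y t)\<^sup>2) \<le> - (c * V t)" for t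
  proof -
    have "2 * (x t * y t) \<le> (x t)\<^sup>2 + (y t)\<^sup>2"
      using sum_squares_bound[of "x t" "y t"] by simp
    then have "(1 + \<mu>) * (2 * (x t * y t)) \<le> (1 + \<mu>) * ((x t)\<^sup>2 + (y t)\<^sup>2)"
      using pos by (intro mult_left_mono) auto
    then have 1: "2 * ((1 + \<mu>) * (x t * y t) - (x t)\<^sup>2 - (y t)\<^sup>2)
        \<le> - ((1 - \<mu>) * ((x t)\<^sup>2 + (y t)\<^sup>2))"
      by (simp add: algebra_simps)
    have "min \<alpha> \<beta> * ((x t)\<^sup>2 / \<alpha>) \<le> \<alpha> * ((x t)\<^sup>2 / \<alpha>)"
      and "min \<alpha> \<beta> * ((y t)\<^sup>2 / \<beta>) \<le> \<beta> * ((y t)\<^sup>2 / \<beta>)"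
      using pos by (intro mult_right_mono; simp)+
    then have "min \<alpha> \<beta> * V t \<le> (x t)\<^sup>2 + (y t)\<^sup>2"
      using pos by (simp add: V_def distrib_left)
    then have "c * V t \<le> (1 - \<mu>) * ((x t)\<^sup>2 + (y t)\<^sup>2)"
      unfolding c_def mult.assoc using pos by (intro mult_left_mono) auto
    with 1 show ?thesis by linarith
  qed
  have bound: "V t \<le> V 1 * exp c * exp (- c * t)" if "1 \<le> t" for t
  proof -
    have "V t * exp (c * t) \<le> V 1 * exp (c * 1)"
    proof (rule DERIV_nonpos_imp_nonincreasing[OF that])
      fix s :: real assume s: "1 \<le> s" "s \<le> t"
      let ?d = "2 * ((1 + \<mu>) * (x s * y s) - (x s)\<^sup>2 - (y s)\<^sup>2)"
      have "((\<lambda>s. V s * exp (c * s)) has_real_derivative (?d + c * V s) * exp (c * s)) (at s)"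
        using s by (auto intro!: derivative_eq_intros V' simp: algebra_simps)
      moreover have "(?d + c * V s) * exp (c * s) \<le> 0"
        using decay[of s] by (simp add: mult_le_0_iff)
      ultimately show "\<exists>d. ((\<lambda>s. V s * exp (c * s)) has_real_derivative d) (at s) \<and> d \<le> 0"
        by blast
    qed
    then have "V t * exp (c * t) * exp (- c * t) \<le> V 1 * exp c * exp (- c * t)"
      by (intro mult_right_mono) auto
    then show ?thesis by (simp add: mult.assoc flip: exp_add)
  qed
  have "((\<lambda>t. exp (- c * t)) \<longlongrightarrow> 0) at_top"
    using filterlim_tendsto_neg_mult_at_bot[OF tendsto_const _ filterlim_ident, of "- c"] c
    by (intro filterlim_compose[OF exp_at_bot]) simp
  then have "((\<lambda>t. V 1 * exp c * exp (- c * t)) \<longlongrightarrow> 0) at_top"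
    by (rule tendsto_mult_right_zero)
  moreover have "0 \<le> V t" for t using pos by (simp add: V_def)
  ultimately have V0: "(V \<longlongrightarrow> 0) at_top"
    using bound by (intro Lim_null_comparison[of V])
      (auto intro!: eventually_at_top_linorderI[of 1])
  have zero: "(u \<longlongrightarrow> 0) at_top"
    if "0 < k" and "\<And>t. (u t)\<^sup>2 / k \<le> V t" for u :: "real \<Rightarrow> real" and k
  proof -
    have "((\<lambda>t. sqrt (k * V t)) \<longlongrightarrow> sqrt (k * 0)) at_top"
      by (intro tendsto_intros V0)
    moreover have "\<bar>u t\<bar> \<le> sqrt (k * V t)" for t
      using that(2)[of t] \<open>0 < k\<close> by (auto intro!: real_le_rsqrt simp: field_simps)
    ultimately show ?thesis
      by (intro Lim_null_comparison[of u "\<lambda>t. sqrt (k * V t)"]) auto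
  qed
  show "(x \<longlongrightarrow> 0) at_top" using pos by (intro zero[of \<alpha>]) (auto simp: V_def)
  show "(y \<longlongrightarrow> 0) at_top" using pos by (intro zero[of \<beta>]) (auto simp: V_def)
qed

lemma mean_opinions_relax:
  assumes pos: "0 < cFL" "0 < cL" "0 < \<kappa>" "0 < \<rho>" and weights: "0 < \<psi>" "0 \<le> \<mu>" "\<psi> + \<mu> = 1"
    and dyn: "mean_opinion_dynamics cFL cL \<rho> \<kappa> \<psi> \<mu> wd mF mL"
  shows "(mF \<longlongrightarrow> wd) at_top" and "(mL \<longlongrightarrow> wd) at_top"
proof -
  let ?x = "\<lambda>t. mF t - wd" and ?y = "\<lambda>t. mL t - wd"
  have \<psi>: "\<psi> = 1 - \<mu>" using weights by simp
  have x: "(?x has_real_derivative \<rho> / cFL * (?y t - ?x t)) (at t)"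
    and y: "(?y has_real_derivative 4 * \<rho> / (cL * \<kappa>) * (\<mu> * ?x t - ?y t)) (at t)" if "0 < t" for t
  proof -
    have F: "(mF has_real_derivative \<rho> / cFL * (mL t - mF t)) (at t)"
      and L: "(mL has_real_derivative
               4 * \<rho> / (cL * \<kappa>) * (\<psi> * (wd - mL t) + \<mu> * (mF t - mL t))) (at t)"
      using dyn that by (auto simp: mean_opinion_dynamics_def)
    show "(?x has_real_derivative \<rho> / cFL * (?y t - ?x t)) (at t)"
      using DERIV_diff[OF F DERIV_const, of wd] by simp
    have "\<psi> * (wd - mL t) + \<mu> * (mF t - mL t) = \<mu> * ?x t - ?y t"
      by (simp add: \<psi> algebra_simps)
    then show "(?y has_real_derivative 4 * \<rho> / (cL * \<kappa>) * (\<mu> * ?x t - ?y t)) (at t)"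
      using DERIV_diff[OF L DERIV_const, of wd] by simp
  qed
  have "(?x \<longlongrightarrow> 0) at_top" "(?y \<longlongrightarrow> 0) at_top"
    using linear_relaxation[of "\<rho> / cFL" "4 * \<rho> / (cL * \<kappa>)" \<mu> ?x ?y] x y pos weights by auto
  then show "(mF \<longlongrightarrow> wd) at_top" "(mL \<longlongrightarrow> wd) at_top"
    by (auto simp: LIM_zero_iff)
qed

section \<open>The steady profile in closed form\<close>

text \<open>The integral of \<open>(z - m) / (1 - z\<^sup>2)\<^sup>2\<close> from \<open>0\<close> to \<open>w\<close>, obtained by partial fractions; the
  constant \<open>1 / 2\<close> makes it vanish at \<open>0\<close>. The two logarithms are kept apart because, for
  \<open>m = \<plusminus>1\<close>, one stays bounded above and the other gives the singularity.\<close>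

definition potential :: "real \<Rightarrow> real \<Rightarrow> real" where
  "potential m w = (1 - m * w) / (2 * (1 - w\<^sup>2)) - 1 / 2 - m / 4 * (ln (1 + w) - ln (1 - w))"

lemma square_less_one: "w\<^sup>2 < 1" if "w \<in> {-1<..<1}" for w :: real
  using that by (simp add: abs_square_less_1 abs_less_iff)

lemma has_derivative_potential:
  assumes "w \<in> {-1<..<1}"
  shows "(potential m has_real_derivative (w - m) / (1 - w\<^sup>2)\<^sup>2) (at w)"
proof -
  have nz: "1 - w\<^sup>2 \<noteq> 0" "0 < 1 + w" "0 < 1 - w" using square_less_one[OF assms] assms by auto
  have f: "1 - w\<^sup>2 = (1 + w) * (1 - w)" by (simp add: algebra_simps power2_eq_square)
  have "(potential m has_real_derivative
      (- m * (2 * (1 - w\<^sup>2)) - (1 - m * w) * (2 * (- 2 * w))) / (2 * (1 - w\<^sup>2))\<^sup>2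
      - m / 4 * (1 / (1 + w) + 1 / (1 - w))) (at w)"
    unfolding potential_def using nz
    by (auto intro!: derivative_eq_intros simp: power2_eq_square)
  moreover have "1 / (1 + w) + 1 / (1 - w) = 2 / (1 - w\<^sup>2)"
    using nz unfolding f by (simp add: field_simps)
  moreover have "(- m * (2 * (1 - w\<^sup>2)) - (1 - m * w) * (2 * (- 2 * w))) / (2 * (1 - w\<^sup>2))\<^sup>2
      - m / 4 * (2 / (1 - w\<^sup>2)) = (w - m) / (1 - w\<^sup>2)\<^sup>2"
  proof -
    have "A / (2 * d)\<^sup>2 - m / 4 * (2 / d) = (A - 2 * m * d) / (4 * d\<^sup>2)" if "d \<noteq> 0" for A d :: real
      using that by (simp add: power_mult_distrib diff_divide_distrib power2_eq_square)
    note this[OF nz(1)]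
    also have "- m * (2 * (1 - w\<^sup>2)) - (1 - m * w) * (2 * (- 2 * w)) - 2 * m * (1 - w\<^sup>2)
        = 4 * (w - m)"
      by (simp add: algebra_simps power2_eq_square)
    also have "4 * (w - m) / (4 * (1 - w\<^sup>2)\<^sup>2) = (w - m) / (1 - w\<^sup>2)\<^sup>2"
      by (rule mult_divide_mult_cancel_left) simp
    finally show ?thesis .
  qed
  ultimately show ?thesis by simp
qed

lemma steady_profile_eq_exp_potential:
  assumes "w \<in> {-1<..<1}"
  shows "steady_profile b m w = exp (- (2 / b) * potential m w)"
proof -
  have inside: "z \<in> {-1<..<1}" if "z \<in> {min 0 w..max 0 w}" for z
    using that assms by (auto simp: min_def max_def split: if_splits)
  have "(LBINT z=ereal 0..ereal w. (z - m) / (1 - z\<^sup>2)\<^sup>2) = potential m w - potential m 0"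
  proof (rule interval_integral_FTC_finite)
    show "continuous_on {min 0 w..max 0 w} (\<lambda>z. (z - m) / (1 - z\<^sup>2)\<^sup>2)"
      using square_less_one[OF inside] by (intro continuous_intros) (fastforce simp: algebra_simps)
    show "(potential m has_vector_derivative (z - m) / (1 - z\<^sup>2)\<^sup>2) (at z within {min 0 w..max 0 w})"
      if "min 0 w \<le> z" "z \<le> max 0 w" for z
      using has_derivative_potential[of z m] inside[of z] that
      by (auto simp flip: has_real_derivative_iff_has_vector_derivative
          intro: has_field_derivative_at_within)
  qed
  then show ?thesis by (simp add: steady_profile_def potential_def zero_ereal_def)
qed

lemma has_derivative_steady_profile:
  assumes "w \<in> {-1<..<1}"
  shows "(steady_profile b m has_real_derivative
           2 / b * ((m - w) / (1 - w\<^sup>2)\<^sup>2) * steady_profile b m w) (at w)"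
proof -
  have "((\<lambda>w. exp (- (2 / b) * potential m w)) has_real_derivative
           2 / b * ((m - w) / (1 - w\<^sup>2)\<^sup>2) * exp (- (2 / b) * potential m w)) (at w)"
    using DERIV_fun_exp[OF DERIV_cmult[OF has_derivative_potential[OF assms, of m], of "- (2 / b)"]]
    by (simp add: mult.commute diff_divide_distrib right_diff_distrib)
  then show ?thesis
    unfolding steady_profile_eq_exp_potential[OF assms, of b m]
    by (rule has_field_derivative_transform_within_open[OF _ open_greaterThanLessThan assms])
       (simp add: steady_profile_eq_exp_potential)
qed

lemma steady_profile_pos: "0 < steady_profile b m w"
  by (simp add: steady_profile_def)

section \<open>Integrability and normalization of the profile\<close>

lemma potential_minimum:
  assumes "m \<in> {-1<..<1}" "w \<in> {-1<..<1}"
  shows "potential m m \<le> potential m w"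
proof (cases "m \<le> w")
  case True
  then show ?thesis
  proof (rule DERIV_nonneg_imp_nondecreasing)
    fix x assume "m \<le> x" "x \<le> w"
    then show "\<exists>d. (potential m has_real_derivative d) (at x) \<and> 0 \<le> d"
      using assms by (intro exI[of _ "(x - m) / (1 - x\<^sup>2)\<^sup>2"] conjI has_derivative_potential) auto
  qed
next
  case False
  then have "w \<le> m" by simp
  then show ?thesis
  proof (rule DERIV_nonpos_imp_nonincreasing)
    fix x assume "w \<le> x" "x \<le> m"
    then show "\<exists>d. (potential m has_real_derivative d) (at x) \<and> d \<le> 0"
      using assms by (intro exI[of _ "(x - m) / (1 - x\<^sup>2)\<^sup>2"] conjI has_derivative_potential)
        (auto simp: divide_le_0_iff)
  qed
qed

text \<open>Treating \<open>m = 1\<close> and \<open>m = -1\<close> together as a sign \<open>s\<close>: the numerator cancels against a factor of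
  \<open>1 - w\<^sup>2 = (1 + s w) (1 - s w)\<close>, and the pole that remains lies at the endpoint opposite to \<open>s\<close>.\<close>

lemma potential_extreme:
  fixes s :: real
  assumes s: "\<bar>s\<bar> = 1" and w: "w \<in> {-1<..<1}"
  shows "potential s w = 1 / (2 * (1 + s * w)) - 1 / 2 - (ln (1 + s * w) - ln (1 - s * w)) / 4"
proof -
  have "1 - w\<^sup>2 = (1 + s * w) * (1 - s * w)" "1 - s * w \<noteq> 0"
    using s w by (auto simp: abs_if algebra_simps power2_eq_square split: if_splits)
  then have "(1 - s * w) / (2 * (1 - w\<^sup>2)) = 1 / (2 * (1 + s * w))" by simp
  moreover have "s * (ln (1 + w) - ln (1 - w)) = ln (1 + s * w) - ln (1 - s * w)"
    using s by (auto simp: abs_if split: if_splits)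
  ultimately show ?thesis by (simp add: potential_def)
qed

lemma set_integrable_powr_endpoint:
  fixes s p :: real
  assumes s: "\<bar>s\<bar> = 1" and p: "p < 1"
  shows "set_integrable lborel {-1<..<1} (\<lambda>w. (1 - s * w) powr (- p))"
proof -
  let ?F = "\<lambda>w. - s * (1 - s * w) powr (1 - p) / (1 - p)"
  have lt: "s * w < 1" if "w \<in> {-1<..<1}" for w
    using s that by (auto simp: abs_if split: if_splits)
  have sign: "s = 1 \<or> s = - 1" using s by (auto simp: abs_if split: if_splits)
  have cont: "continuous_on {-1..1} ?F"
    using s p
    by (intro continuous_on_divide continuous_on_mult continuous_on_powr' continuous_on_diff
        continuous_on_const continuous_on_id) (auto simp: abs_if split: if_splits)
  have "set_integrable lborel (einterval (ereal (-1)) (ereal 1)) (\<lambda>w. (1 - s * w) powr (- p))"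
  proof (rule interval_integral_FTC_nonneg(1))
    show "ereal (- 1) < ereal 1" by simp
    show "DERIV ?F x :> (1 - s * x) powr (- p)"
      if "ereal (- 1) < ereal x" "ereal x < ereal 1" for x
    proof -
      have "((\<lambda>w. 1 - s * w) has_real_derivative - s) (at x)"
        by (auto intro!: derivative_eq_intros)
      then have "((\<lambda>w. (1 - s * w) powr (1 - p)) has_real_derivative
          (1 - p) * (1 - s * x) powr (- p) * (- s)) (at x)"
        using DERIV_fun_powr[of "\<lambda>w. 1 - s * w" "- s" x "1 - p"] lt[of x] that by simp
      from DERIV_cmult[OF this, of "- s / (1 - p)"] show ?thesis
        using p sign by auto
    qed
    show "isCont (\<lambda>w. (1 - s * w) powr (- p)) x"
      if "ereal (- 1) < ereal x" "ereal x < ereal 1" for x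
      using that lt[of x] by (auto intro!: continuous_intros)
    show "AE x in lborel. ereal (- 1) < ereal x \<longrightarrow> ereal x < ereal 1 \<longrightarrow> 0 \<le> (1 - s * x) powr (- p)"
      by simp
    show "((?F \<circ> real_of_ereal) \<longlongrightarrow> ?F (-1)) (at_right (ereal (- 1)))"
      unfolding ereal_tendsto_simps1
      using cont by (intro continuous_on_Icc_at_rightD) auto
    show "((?F \<circ> real_of_ereal) \<longlongrightarrow> ?F 1) (at_left (ereal 1))"
      unfolding ereal_tendsto_simps1
      using cont by (intro continuous_on_Icc_at_leftD) auto
  qed
  then show ?thesis by (simp add: einterval_eq_Icc)
qed

text \<open>For \<open>\<bar>m\<bar> = 1\<close> the term \<open>1 / (2 (1 + m w))\<close> of the potential only makes the profile
  smaller and can be dropped; bounding \<open>1 + m w\<close> by \<open>2\<close> leaves an integrable power of \<open>1 - m w\<close>.\<close>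

lemma set_integrable_steady_profile:
  assumes b: "0 < b" and m: "m \<in> {-1..1}" and cond: "\<bar>m\<bar> < 1 \<or> 1 / 2 < b"
  shows "set_integrable lborel {-1<..<1} (steady_profile b m)"
proof -
  have meas: "set_borel_measurable lborel {-1<..<1} (steady_profile b m)"
  proof -
    have cont: "continuous_on {-1<..<1} (steady_profile b m)"
      by (meson DERIV_isCont continuous_at_imp_continuous_on has_derivative_steady_profile)
    then show ?thesis
      unfolding set_borel_measurable_def
      using borel_measurable_continuous_on_indicator[OF _ cont] by simp
  qed
  show ?thesis
  proof (cases "\<bar>m\<bar> < 1")
    case True
    let ?C = "exp (- (2 / b) * potential m m)"
    have "set_integrable lborel {-1<..<1} (\<lambda>w::real. ?C)"
      by (auto simp: set_integrable_def)
    then show ?thesis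
    proof (rule set_integrable_bound[OF _ meas])
      show "AE w in lborel. w \<in> {-1<..<1} \<longrightarrow> norm (steady_profile b m w) \<le> norm ?C"
        using True b potential_minimum[of m]
        by (auto simp: steady_profile_eq_exp_potential abs_less_iff divide_right_mono)
    qed
  next
    case False
    then have m1: "\<bar>m\<bar> = 1" and b2: "1 / 2 < b" using m cond by auto
    let ?C = "exp (1 / b) * 2 powr (1 / (2 * b))"
    have "set_integrable lborel {-1<..<1} (\<lambda>w. ?C * (1 - m * w) powr (- (1 / (2 * b))))"
      using m1 b b2 by (intro set_integrable_mult_right set_integrable_powr_endpoint) (auto simp: field_simps)
    then show ?thesis
    proof (rule set_integrable_bound[OF _ meas], intro AE_I2 impI)
      fix w :: real assume w: "w \<in> {-1<..<1}"
      have mw: "0 < 1 + m * w" "1 + m * w < 2" "0 < 1 - m * w"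
        using m1 w by (auto simp: abs_if split: if_splits)
      have "- (2 / b) * potential m w
          = 1 / b - 1 / (b * (1 + m * w)) + 1 / (2 * b) * ln (1 + m * w) - 1 / (2 * b) * ln (1 - m * w)"
      proof -
        have "- (2 / b) * (1 / (2 * u) - 1 / 2 - (p - q) / 4)
            = 1 / b - 1 / (b * u) + 1 / (2 * b) * p - 1 / (2 * b) * q" for u p q
          by (simp add: right_diff_distrib diff_divide_distrib)
        then show ?thesis unfolding potential_extreme[OF m1 w] .
      qed
      also have "\<dots> \<le> 1 / b + 1 / (2 * b) * ln 2 - 1 / (2 * b) * ln (1 - m * w)"
      proof -
        have "1 / (2 * b) * ln (1 + m * w) \<le> 1 / (2 * b) * ln 2"
          using b mw by (intro mult_left_mono) auto
        moreover have "0 \<le> 1 / (b * (1 + m * w))" using b mw by simp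
        ultimately show ?thesis by linarith
      qed
      finally have "steady_profile b m w \<le> exp \<dots>"
        unfolding steady_profile_eq_exp_potential[OF w] by simp
      also have "\<dots> = ?C * (1 - m * w) powr (- (1 / (2 * b)))"
        using mw by (simp add: powr_def flip: exp_add)
      finally show "norm (steady_profile b m w) \<le> norm (?C * (1 - m * w) powr (- (1 / (2 * b))))"
        using steady_profile_pos[of b m w] by (simp add: abs_mult)
    qed
  qed
qed

text \<open>The steady state is described in the open interval only: at the endpoints the equation
  degenerates and the values of the density and of the profile carry no information.\<close>

lemma integral_opinion_space_eq_interior:
  fixes f :: "real \<Rightarrow> real"
  shows "(LBINT w:opinion_space. f w) = (LBINT w:{-1<..<1}. f w)"
  by (rule set_integral_discrete_difference[where X = "{-1, 1}"]) (auto simp: opinion_space_def)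

lemma integral_opinion_space_cong:
  fixes f g :: "real \<Rightarrow> real"
  assumes "\<And>w. w \<in> {-1<..<1} \<Longrightarrow> f w = g w"
  shows "(LBINT w:opinion_space. f w) = (LBINT w:opinion_space. g w)"
  unfolding integral_opinion_space_eq_interior
  using assms by (intro set_lebesgue_integral_cong) auto

lemma normalization_unique:
  assumes "0 < b" and "m \<in> {-1..1}" and "\<bar>m\<bar> < 1 \<or> 1 / 2 < b"
  shows "\<exists>!a. (LBINT w:opinion_space. a * steady_profile b m w) = 1"
proof -
  define I where "I = (LBINT w:{-1<..<1}. steady_profile b m w)"
  have int: "integrable lborel (\<lambda>w. indicat_real {-1<..<1} w *\<^sub>R steady_profile b m w)"
    using set_integrable_steady_profile[OF assms] by (simp add: set_integrable_def)
  have "I \<noteq> 0"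
  proof
    assume "I = 0"
    then have "AE w in lborel. indicat_real {-1<..<1} w *\<^sub>R steady_profile b m w = 0"
      using integral_nonneg_eq_0_iff_AE[OF int] steady_profile_pos[of b m, THEN less_imp_le]
      by (simp add: I_def set_lebesgue_integral_def)
    then have "AE w in lborel. w \<notin> {-1<..<1::real}"
      by eventually_elim (use steady_profile_pos[of b m] in \<open>auto simp: indicator_def less_le\<close>)
    then have "{-1<..<1::real} \<in> null_sets lborel"
      by (subst AE_iff_null_sets) auto
    then show False by (auto simp: null_sets_def)
  qed
  moreover have "(LBINT w:opinion_space. a * steady_profile b m w) = a * I" for a
    unfolding integral_opinion_space_eq_interior I_def by simp
  ultimately show ?thesis
    by (metis nonzero_eq_divide_eq)
qed

section \<open>The steady state of the followers\<close>

lemma density_from_weighted_density: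
  assumes "w \<in> {-1<..<1}"
  shows "(local_diffusion w)\<^sup>2 * x = y \<longleftrightarrow> x = y / (1 - w\<^sup>2)\<^sup>2"
proof -
  have "(1 - w\<^sup>2)\<^sup>2 \<noteq> 0" using square_less_one[OF assms] by simp
  then have "(1 - w\<^sup>2)\<^sup>2 * x = y \<longleftrightarrow> x = y / (1 - w\<^sup>2)\<^sup>2"
    by (metis nonzero_mult_div_cancel_left nonzero_eq_divide_eq mult.commute)
  then show ?thesis unfolding local_diffusion_def .
qed

text \<open>The reason for \<open>b_F\<close>: once both means equal \<open>wd\<close>, dividing the flux equation by the total
  relaxation rate leaves \<open>b_F / 2\<close> as its only parameter besides \<open>wd\<close>.\<close>

lemma b_F_rate_quotient:
  assumes "0 < cF" "0 < cFL" "0 < \<rho>"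
  shows "(1 / cF + \<rho> / cFL) * b_F cF cFL \<rho> \<sigma> \<sigma>' = 2 * diffusion_coeff cF cFL \<rho> \<sigma> \<sigma>'"
proof -
  have "0 < cFL + cF * \<rho>" using assms by (simp add: add_pos_pos)
  moreover have "1 / cF + \<rho> / cFL = (cFL + cF * \<rho>) / (cF * cFL)"
    using assms by (simp add: field_simps)
  ultimately show ?thesis
    using assms by (simp add: b_F_def diffusion_coeff_def) (simp add: field_simps)
qed

lemma b_F_pos:
  assumes "0 < cF" "0 < cFL" "0 < \<rho>" "\<sigma> \<noteq> 0 \<or> \<sigma>' \<noteq> 0"
  shows "0 < b_F cF cFL \<rho> \<sigma> \<sigma>'"
proof -
  have "0 < \<sigma>\<^sup>2 * cFL + \<sigma>'\<^sup>2 * cF * \<rho>"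
  proof (cases "\<sigma> = 0")
    case True
    then show ?thesis using assms by simp
  next
    case False
    then show ?thesis using assms by (intro add_pos_nonneg) auto
  qed
  then show ?thesis using assms by (simp add: b_F_def add_pos_pos)
qed

text \<open>Both directions rest on the profile solving the same first-order linear equation as \<open>D\<^sup>2 f\<close>:
  multiples of it are solutions, and since it is positive, the quotient of a solution by it is
  differentiable with derivative zero.\<close>

lemma zero_flux_state_iff_profile:
  fixes cF cFL \<rho> \<sigma> \<sigma>' :: real
  defines "b \<equiv> b_F cF cFL \<rho> \<sigma> \<sigma>'"
  assumes pos: "0 < cF" "0 < cFL" "0 < \<rho>" and noise: "\<sigma> \<noteq> 0 \<or> \<sigma>' \<noteq> 0"
  shows "zero_flux_state cF cFL \<rho> \<sigma> \<sigma>' m m f \<longleftrightarrow>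
    (\<exists>a. \<forall>w\<in>{-1<..<1}. (local_diffusion w)\<^sup>2 * f w = a * steady_profile b m w)"
proof -
  define g where "g w = (local_diffusion w)\<^sup>2 * f w" for w
  define K where "K = 1 / cF + \<rho> / cFL"
  have b: "0 < b" unfolding b_def using b_F_pos[OF pos noise] .
  have K: "0 < K" using pos by (simp add: K_def add_pos_pos)
  have coeff: "diffusion_coeff cF cFL \<rho> \<sigma> \<sigma>' = K * b / 2"
    using b_F_rate_quotient[OF pos, of \<sigma> \<sigma>'] by (simp add: K_def b_def)
  have drift: "follower_drift cF cFL \<rho> m m w = K * (m - w)" for w
    by (simp add: follower_drift_def K_def algebra_simps)
  have flux: "follower_drift cF cFL \<rho> m m w * f w = diffusion_coeff cF cFL \<rho> \<sigma> \<sigma>' * d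
      \<longleftrightarrow> d = 2 / b * ((m - w) / (1 - w\<^sup>2)\<^sup>2) * g w" if w: "w \<in> {-1<..<1}" for w d
  proof -
    have "f w = g w / (1 - w\<^sup>2)\<^sup>2"
      using density_from_weighted_density[OF w, of "f w" "g w"] by (simp add: g_def)
    then have "follower_drift cF cFL \<rho> m m w * f w = K * ((m - w) / (1 - w\<^sup>2)\<^sup>2 * g w)"
      unfolding drift by simp
    moreover have "K * q = K * b / 2 * d \<longleftrightarrow> d = 2 / b * q" for q
      using b K by (auto simp: field_simps)
    ultimately show ?thesis unfolding coeff by (simp only: mult.assoc)
  qed
  have ode: "zero_flux_state cF cFL \<rho> \<sigma> \<sigma>' m m f \<longleftrightarrow>
    (\<forall>w\<in>{-1<..<1}. (g has_real_derivative 2 / b * ((m - w) / (1 - w\<^sup>2)\<^sup>2) * g w) (at w))"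
  proof -
    have g: "(\<lambda>x. (local_diffusion x)\<^sup>2 * f x) = g" by (simp add: g_def fun_eq_iff)
    show ?thesis
      unfolding zero_flux_state_def g
    proof (intro ball_cong refl)
      fix w :: real assume w: "w \<in> {-1<..<1}"
      show "(g field_differentiable at w \<and>
          follower_drift cF cFL \<rho> m m w * f w = diffusion_coeff cF cFL \<rho> \<sigma> \<sigma>' * deriv g w)
        \<longleftrightarrow> (g has_real_derivative 2 / b * ((m - w) / (1 - w\<^sup>2)\<^sup>2) * g w) (at w)"
        unfolding flux[OF w]
        by (metis DERIV_deriv_iff_field_differentiable DERIV_imp_deriv field_differentiable_def)
    qed
  qed
  show ?thesis unfolding ode g_def[symmetric]
  proof safe
    assume g': "\<forall>w\<in>{-1<..<1}. (g has_real_derivative 2 / b * ((m - w) / (1 - w\<^sup>2)\<^sup>2) * g w) (at w)"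
    let ?q = "\<lambda>w. g w / steady_profile b m w"
    have "\<exists>a. \<forall>w\<in>{-1<..<1}. ?q w = a"
    proof (rule has_field_derivative_zero_constant)
      show "convex {-1<..<1::real}" by simp
      fix w :: real assume w: "w \<in> {-1<..<1}"
      have "(?q has_real_derivative 0) (at w)"
        using DERIV_divide[OF g'[rule_format, OF w] has_derivative_steady_profile[OF w, of b m]]
          steady_profile_pos[of b m w] by (simp add: mult_ac)
      then show "(?q has_real_derivative 0) (at w within {-1<..<1})"
        by (rule has_field_derivative_at_within)
    qed
    then show "\<exists>a. \<forall>w\<in>{-1<..<1}. g w = a * steady_profile b m w"
      using steady_profile_pos[of b m] by (auto simp: field_simps less_imp_neq[symmetric])
  next
    fix a w :: real
    assume g: "\<forall>w\<in>{-1<..<1}. g w = a * steady_profile b m w" and w: "w \<in> {-1<..<1}"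
    have "((\<lambda>w. a * steady_profile b m w) has_real_derivative
        2 / b * ((m - w) / (1 - w\<^sup>2)\<^sup>2) * g w) (at w)"
      using DERIV_cmult[OF has_derivative_steady_profile[OF w, of b m], of a] g w
      by (simp add: mult_ac)
    then show "(g has_real_derivative 2 / b * ((m - w) / (1 - w\<^sup>2)\<^sup>2) * g w) (at w)"
      using w g by (rule_tac has_field_derivative_transform_within_open[where S = "{-1<..<1}"]) auto
  qed
qed

theorem mainTheorem3:
  fixes cF cFL cL \<rho> \<sigma> \<sigma>' \<kappa> \<psi> \<mu> wd :: real
    and fF fL :: "real \<Rightarrow> real \<Rightarrow> real"
    and mF mL :: "real \<Rightarrow> real"
  assumes "0 < cF" and "0 < cFL" and "0 < cL" and "0 < \<kappa>"
    and "0 < \<rho>" and "\<rho> \<le> 1"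
    and "\<sigma> \<noteq> 0 \<or> \<sigma>' \<noteq> 0"
    and "0 < \<psi>" and "0 \<le> \<mu>" and "\<psi> + \<mu> = 1"
    and "wd \<in> opinion_space"
    and "opinion_density fF" and "opinion_density fL"
    and "\<forall>t>0. (LBINT w:opinion_space. fL w t) = \<rho>"
    and "mF = follower_mean fF" and "mL = leader_mean \<rho> fL"
    and "follower_fokker_planck cF cFL \<rho> \<sigma> \<sigma>' mF mL fF"
    and "mean_opinion_dynamics cFL cL \<rho> \<kappa> \<psi> \<mu> wd mF mL"
  shows
    "(mF \<longlongrightarrow> wd) at_top \<and> (mL \<longlongrightarrow> wd) at_top \<and>
     (\<forall>f. follower_steady_state cF cFL \<rho> \<sigma> \<sigma>' mF mL f \<longrightarrow>
        (\<forall>w\<in>{-1<..<1}.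
           (\<lambda>x. (local_diffusion x)\<^sup>2 * f x) field_differentiable at w \<and>
           (1 / cF + \<rho> / cFL) * (wd - w) * f w
           = 1 / 2 * (\<sigma>\<^sup>2 / cF + \<sigma>'\<^sup>2 * \<rho> / cFL)
             * deriv (\<lambda>x. (local_diffusion x)\<^sup>2 * f x) w)) \<and>
     (\<bar>wd\<bar> < 1 \<or> 1 / 2 < b_F cF cFL \<rho> \<sigma> \<sigma>' \<longrightarrow>
        (\<exists>!a. (LBINT w:opinion_space. a * steady_profile (b_F cF cFL \<rho> \<sigma> \<sigma>') wd w) = 1)) \<and>
     (\<forall>f. follower_steady_state cF cFL \<rho> \<sigma> \<sigma>' mF mL f \<and>
          (LBINT w:opinion_space. (local_diffusion w)\<^sup>2 * f w) = 1
        \<longleftrightarrow>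
        (\<exists>a. (LBINT w:opinion_space. a * steady_profile (b_F cF cFL \<rho> \<sigma> \<sigma>') wd w) = 1 \<and>
          (\<forall>w\<in>{-1<..<1}.
             (local_diffusion w)\<^sup>2 * f w = a * steady_profile (b_F cF cFL \<rho> \<sigma> \<sigma>') wd w \<and>
             f w = a / (1 - w\<^sup>2)\<^sup>2 * steady_profile (b_F cF cFL \<rho> \<sigma> \<sigma>') wd w)))"
proof -
  let ?b = "b_F cF cFL \<rho> \<sigma> \<sigma>'"
  have lim: "(mF \<longlongrightarrow> wd) at_top" "(mL \<longlongrightarrow> wd) at_top"
    by (fact mean_opinions_relax[OF assms(2-5,8-10,18)])+
  have "mF_inf = wd" "mL_inf = wd" if "(mF \<longlongrightarrow> mF_inf) at_top" "(mL \<longlongrightarrow> mL_inf) at_top"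
    for mF_inf mL_inf
    using that lim by (auto dest: tendsto_unique[OF trivial_limit_at_top_linorder])
  then have steady: "follower_steady_state cF cFL \<rho> \<sigma> \<sigma>' mF mL f
      \<longleftrightarrow> zero_flux_state cF cFL \<rho> \<sigma> \<sigma>' wd wd f" for f
    unfolding follower_steady_state_def using lim by metis
  have equation: "(\<lambda>x. (local_diffusion x)\<^sup>2 * f x) field_differentiable at w \<and>
           (1 / cF + \<rho> / cFL) * (wd - w) * f w
           = 1 / 2 * (\<sigma>\<^sup>2 / cF + \<sigma>'\<^sup>2 * \<rho> / cFL)
             * deriv (\<lambda>x. (local_diffusion x)\<^sup>2 * f x) w"
    if "follower_steady_state cF cFL \<rho> \<sigma> \<sigma>' mF mL f" "w \<in> {-1<..<1}" for f w
    using that unfolding steady zero_flux_state_def follower_drift_def diffusion_coeff_def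
    by (simp add: distrib_right)
  have normalization: "\<exists>!a. (LBINT w:opinion_space. a * steady_profile ?b wd w) = 1"
    if "\<bar>wd\<bar> < 1 \<or> 1 / 2 < ?b"
    using normalization_unique[of ?b wd] b_F_pos[of cF cFL \<rho> \<sigma> \<sigma>'] that assms
    by (auto simp: opinion_space_def)
  have profile: "follower_steady_state cF cFL \<rho> \<sigma> \<sigma>' mF mL f \<and>
          (LBINT w:opinion_space. (local_diffusion w)\<^sup>2 * f w) = 1
        \<longleftrightarrow>
        (\<exists>a. (LBINT w:opinion_space. a * steady_profile ?b wd w) = 1 \<and>
          (\<forall>w\<in>{-1<..<1}.
             (local_diffusion w)\<^sup>2 * f w = a * steady_profile ?b wd w \<and>
             f w = a / (1 - w\<^sup>2)\<^sup>2 * steady_profile ?b wd w))" for f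
  proof -
    have mass: "(LBINT w:opinion_space. (local_diffusion w)\<^sup>2 * f w)
        = (LBINT w:opinion_space. a * steady_profile ?b wd w)"
      if "\<forall>w\<in>{-1<..<1}. (local_diffusion w)\<^sup>2 * f w = a * steady_profile ?b wd w" for a
      using that by (intro integral_opinion_space_cong) auto
    have "f w = a / (1 - w\<^sup>2)\<^sup>2 * steady_profile ?b wd w
        \<longleftrightarrow> (local_diffusion w)\<^sup>2 * f w = a * steady_profile ?b wd w"
      if "w \<in> {-1<..<1}" for a w
      using density_from_weighted_density[OF that] by simp
    then show ?thesis
      unfolding steady zero_flux_state_iff_profile[OF assms(1,2,5,7)]
      using mass by (metis (no_types, lifting))
  qed
  show ?thesis using lim equation normalization profile by blast
qed

end
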